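(* For $D>0$ let $\overline{\lambda}_1(D)$ and $\overline{\lambda}_2(D)$ be the first two Dirichlet eigenvalues of the operator $-\frac{d^2}{ds^2}+s\frac{d}{ds}$ on the interval $(-D/2,D/2)$. Then $(\overline{\lambda}_2(D) - \overline{\lambda}_1(D))D^2$ is increasing in $D$, that is, $$\frac{d}{dD}\left[\left(\overline{\lambda}_2(D) - \overline{\lambda}_1(D)\right)D^2\right]> 0 .$$ Moreover, $$\lim_{D\rightarrow0^+} \left(\overline{\lambda}_2(D) - \overline{\lambda}_1(D)\right)D^2 =3\pi^2.$$
   Context: The Dirichlet eigenvalues $\overline\lambda_1(D)<\overline\lambda_2(D)<\dots$ are the real numbers $\lambda$ for which $-u''(s)+su'(s)=\lambda u(s)$ on $(-D/2,D/2)$, $u(\pm D/2)=0$, has a nonzero solution, listed in increasing order. *)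

theory Defs
  imports "HOL-Analysis.Analysis"
begin

(* Classical solutions: continuous up to the boundary, where the values are prescribed,
   and twice differentiable in the interior.  Values of u outside the closed interval
   are irrelevant, so "nonzero" is asserted inside the interval. *)
definition dirichlet_eigenfunction :: "real \<Rightarrow> real \<Rightarrow> (real \<Rightarrow> real) \<Rightarrow> bool" where
  "dirichlet_eigenfunction D l u \<longleftrightarrow>
     continuous_on {-D/2..D/2} u \<and> u (-D/2) = 0 \<and> u (D/2) = 0 \<and>
     (\<exists>s\<in>{-D/2<..<D/2}. u s \<noteq> 0) \<and>
     (\<exists>u' u''. \<forall>s\<in>{-D/2<..<D/2}.
        (u has_real_derivative u' s) (at s) \<and>
        (u' has_real_derivative u'' s) (at s) \<and>
        - u'' s + s * u' s = l * u s)"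

definition is_dirichlet_eigenvalue :: "real \<Rightarrow> real \<Rightarrow> bool" where
  "is_dirichlet_eigenvalue D l \<longleftrightarrow> (\<exists>u. dirichlet_eigenfunction D l u)"

(* The eigenvalue at position k (counted from 1) in the increasing enumeration of the
   set of eigenvalues, i.e. the one with exactly k eigenvalues up to and including it.
   As in the strict ordering of a set, multiplicities are not counted. *)
definition dirichlet_eigenvalue :: "nat \<Rightarrow> real \<Rightarrow> real" where
  "dirichlet_eigenvalue k D =
     (THE l. is_dirichlet_eigenvalue D l \<and>
             finite {m. is_dirichlet_eigenvalue D m \<and> m \<le> l} \<and>
             card {m. is_dirichlet_eigenvalue D m \<and> m \<le> l} = k)"

lemma dirichlet_eigenvalue_eqI:
  assumes "is_dirichlet_eigenvalue D l"
    and "finite {m. is_dirichlet_eigenvalue D m \<and> m \<le> l}"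
    and "card {m. is_dirichlet_eigenvalue D m \<and> m \<le> l} = k"
  shows "dirichlet_eigenvalue k D = l"
proof -
  let ?S = "\<lambda>l. {m. is_dirichlet_eigenvalue D m \<and> m \<le> l}"
  have less: "card (?S a) < card (?S b)"
    if "a < b" "is_dirichlet_eigenvalue D b" "finite (?S b)" for a b
  proof (rule psubset_card_mono)
    show "finite (?S b)" by fact
    have "b \<in> ?S b" "b \<notin> ?S a" using that by auto
    moreover have "?S a \<subseteq> ?S b" using that by auto
    ultimately show "?S a \<subset> ?S b" by blast
  qed
  show ?thesis
    unfolding dirichlet_eigenvalue_def
  proof (rule the_equality)
    show "is_dirichlet_eigenvalue D l \<and> finite (?S l) \<and> card (?S l) = k"
      using assms by blast
    show "a = l" if "is_dirichlet_eigenvalue D a \<and> finite (?S a) \<and> card (?S a) = k" for a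
      using less[of a l] less[of l a] that assms by (cases a l rule: linorder_cases) auto
  qed
qed

end

(*
  Proof idea.  Even and odd solutions of -u'' + s u' = l u are given by power series, and l is an
  eigenvalue iff the even or the odd one vanishes at R = D/2; the first two eigenvalues belong to
  an even and an odd solution without zeros in (0, R).  Putting s = R x and
  v(x) = u(R x) exp(-(R x)^2/4) turns the equation into v'' = (t x^2 - m) v on [0, 1] with
  t = R^4/4 and m = R^2 (l + 1/2), so that g = 4 (m2 - m1).  For two such problems Green's identity gives
  (m - m') int v w = (t - t') int x^2 v w.  Hence 0 <= m - m' <= t - t' for t >= t', which yields
  continuity and, for t' = 0, the limit; moreover dm/dt = int x^2 v^2 / int v^2.  This quotient is
  larger for the second eigenfunction, as v2/v1 is increasing on (0, 1).
*)

theory Submission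
  imports Defs
begin


section \<open>Power series solutions\<close>

text \<open>\<open>hsol a b l\<close> is the solution of \<open>- u'' + s u' = l u\<close> with \<open>u 0 = a\<close> and \<open>u' 0 = b\<close>.\<close>

fun hcoeff :: "real \<Rightarrow> real \<Rightarrow> real \<Rightarrow> nat \<Rightarrow> real" where
  "hcoeff a b l 0 = a"
| "hcoeff a b l (Suc 0) = b"
| "hcoeff a b l (Suc (Suc n)) = (real n - l) / ((real n + 1) * (real n + 2)) * hcoeff a b l n"

definition hsol :: "real \<Rightarrow> real \<Rightarrow> real \<Rightarrow> real \<Rightarrow> real" where
  "hsol a b l s = (\<Sum>n. hcoeff a b l n * s ^ n)"

lemma hcoeff_even: "hcoeff a 0 l (Suc (2 * k)) = 0"
  by (induction k) auto

lemma hcoeff_odd: "hcoeff 0 b l (2 * k) = 0"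
  by (induction k) auto

lemma hcoeff_nonneg: "a \<ge> 0 \<Longrightarrow> b \<ge> 0 \<Longrightarrow> l \<le> 0 \<Longrightarrow> hcoeff a b l n \<ge> 0"
  by (induction a b l n rule: hcoeff.induct) auto

text \<open>As |n - l| \<le> n + \<open>L\<close>, the recurrence with \<open>- L\<close> and
  absolute initial values dominates. The bound is again a coefficient sequence of this kind, hence
  summable at every radius, and is uniform in \<open>l\<close>.\<close>

lemma hcoeff_majorant:
  assumes "\<bar>l\<bar> \<le> L"
  shows "\<bar>hcoeff a b l n\<bar> \<le> hcoeff \<bar>a\<bar> \<bar>b\<bar> (- L) n"
  using assms
proof (induction a b l n rule: hcoeff.induct)
  case (3 a b l n)
  have "\<bar>(real n - l) / ((real n + 1) * (real n + 2))\<bar>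
          \<le> (real n - - L) / ((real n + 1) * (real n + 2))"
    using 3(2) by (auto simp: abs_mult intro!: divide_right_mono)
  then show ?case
    unfolding hcoeff.simps abs_mult using 3 by (intro mult_mono) auto
qed auto

lemma hcoeff_rec:
  "(real n + 1) * ((real n + 2) * hcoeff a b l (Suc (Suc n))) = (real n - l) * hcoeff a b l n"
proof -
  have "real n + 1 \<noteq> 0" "real n + 2 \<noteq> 0" by linarith+
  then show ?thesis by simp
qed

text \<open>Differentiating the equation shows that \<open>u'\<close> solves it with
  \<open>l - 1\<close> in place of \<open>l\<close>; its initial values are \<open>b\<close> and
  \<open>u'' 0 = - l * a\<close>. So derivatives stay within the family \<open>hsol\<close>.\<close>

lemma hcoeff_diffs: "diffs (hcoeff a b l) = hcoeff b (- l * a) (l - 1)"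
proof
  show "diffs (hcoeff a b l) n = hcoeff b (- l * a) (l - 1) n" for n
  proof (induction n rule: nat_induct2)
    case (step n)
    let ?d = "hcoeff b (- l * a) (l - 1)"
    have nz: "(real n + 1) * (real n + 2) \<noteq> 0" by (simp add: add_nonneg_pos)
    have IH: "(real n + 1) * hcoeff a b l (Suc n) = ?d n"
      using step by (simp add: diffs_def add.commute)
    have "(real n + 1) * (real n + 2) * diffs (hcoeff a b l) (n + 2)
        = (real n + 1) * ((real (Suc n) + 1) * ((real (Suc n) + 2) * hcoeff a b l (Suc (Suc (Suc n)))))"
      by (simp add: diffs_def del: hcoeff.simps)
    also have "\<dots> = (real n + 1) * ((real (Suc n) - l) * hcoeff a b l (Suc n))"
      by (simp only: hcoeff_rec)
    also have "\<dots> = (real (Suc n) - l) * ((real n + 1) * hcoeff a b l (Suc n))"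
      by (simp only: mult.left_commute)
    also have "\<dots> = (real n - (l - 1)) * ?d n"
      by (simp only: IH) simp
    also have "\<dots> = (real n + 1) * (real n + 2) * ?d (n + 2)"
      using hcoeff_rec[of n b "- l * a" "l - 1"] by (simp add: mult.assoc del: hcoeff.simps)
    finally show ?case using nz by (simp only: mult_cancel_left) simp
  qed (simp_all add: diffs_def)
qed

lemma summable_real_even_odd:
  fixes f :: "nat \<Rightarrow> real"
  assumes "summable (\<lambda>k. f (2 * k))" "summable (\<lambda>k. f (Suc (2 * k)))"
  shows "summable f"
proof -
  have "(\<lambda>n. if even n then f (2 * (n div 2)) else f (Suc (2 * ((n - 1) div 2)))) sums
      (suminf (\<lambda>k. f (Suc (2 * k))) + suminf (\<lambda>k. f (2 * k)))"
    by (rule sums_if) (use assms in \<open>auto intro: summable_sums\<close>)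
  moreover have "(\<lambda>n. if even n then f (2 * (n div 2)) else f (Suc (2 * ((n - 1) div 2)))) = f"
    by (auto simp: fun_eq_iff elim!: oddE)
  ultimately show ?thesis by (auto simp: summable_def)
qed

lemma summable_hcoeff: "summable (\<lambda>n. hcoeff a b l n * x ^ n)"
proof -
  define f where "f = (\<lambda>n. hcoeff a b l n * x ^ n)"
  \<comment> \<open>The recurrence links terms two apart; their ratio is at most
    \<open>K / (n + 2)\<close>, hence at most 1/2 from \<open>N\<close> on. The ratio test then runs
    on even and odd indices separately.\<close>
  define K where "K = (1 + \<bar>l\<bar>) * x\<^sup>2"
  obtain N where N: "real N > 2 * K" using reals_Archimedean2 by blast
  have step: "norm (f (Suc (Suc n))) \<le> 1/2 * norm (f n)" if "n \<ge> N" for n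
  proof -
    have "\<bar>real n - l\<bar> \<le> (1 + \<bar>l\<bar>) * (real n + 1)"
    proof -
      have "0 \<le> \<bar>l\<bar> * real n" by simp
      then show ?thesis unfolding ring_distribs by linarith
    qed
    then have "\<bar>(real n - l) / ((real n + 1) * (real n + 2))\<bar> \<le> (1 + \<bar>l\<bar>) / (real n + 2)"
      by (simp add: abs_mult divide_simps)
    then have "\<bar>(real n - l) / ((real n + 1) * (real n + 2))\<bar> * x\<^sup>2 \<le> (1 + \<bar>l\<bar>) / (real n + 2) * x\<^sup>2"
      by (rule mult_right_mono) auto
    also have "\<dots> = K / (real n + 2)" by (simp add: K_def)
    also have "\<dots> \<le> 1/2" using N that by (simp add: divide_simps)
    finally have "\<bar>(real n - l) / ((real n + 1) * (real n + 2))\<bar> * x\<^sup>2 * norm (f n) \<le> 1/2 * norm (f n)"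
      by (rule mult_right_mono) auto
    moreover have "x\<^sup>2 = \<bar>x\<bar> * \<bar>x\<bar>" by (simp add: power2_eq_square)
    ultimately show ?thesis
      by (simp add: f_def abs_mult power_abs mult_ac del: abs_mult_self_eq)
  qed
  have "summable f"
  proof (rule summable_real_even_odd)
    show "summable (\<lambda>k. f (2 * k))"
      by (rule summable_ratio_test[of "1/2" N]) (use step in auto)
    show "summable (\<lambda>k. f (Suc (2 * k)))"
      by (rule summable_ratio_test[of "1/2" N]) (use step in auto)
  qed
  then show ?thesis by (simp add: f_def)
qed

lemma hsol_0: "hsol a b l 0 = a"
  unfolding hsol_def by (subst powser_zero) simp

lemma hsol_deriv:
  "(hsol a b l has_real_derivative hsol b (- l * a) (l - 1) s) (at s)"
  unfolding hsol_def hcoeff_diffs[symmetric]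
  by (rule termdiffs_strong_converges_everywhere[OF summable_hcoeff])

text \<open>By \<open>hcoeff_diffs\<close> applied twice, the left side is the second derivative of
  \<open>hsol a b l\<close>, so this is the differential equation, checked coefficientwise.\<close>

lemma hsol_ode:
  "hsol (- l * a) (- (l - 1) * b) (l - 1 - 1) s = s * hsol b (- l * a) (l - 1) s - l * hsol a b l s"
proof -
  define c where "c = hcoeff a b l"
  have 1: "(\<lambda>n. real n * c n * s ^ n) sums (s * hsol b (- l * a) (l - 1) s)"
  proof -
    have "(\<lambda>n. s * (diffs c n * s ^ n)) sums (s * hsol b (- l * a) (l - 1) s)"
      unfolding hsol_def c_def hcoeff_diffs by (intro sums_mult summable_sums summable_hcoeff)
    then have "(\<lambda>n. real (Suc n) * c (Suc n) * s ^ Suc n) sums (s * hsol b (- l * a) (l - 1) s)"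
      by (simp add: diffs_def mult_ac)
    then show ?thesis by (subst (asm) sums_Suc_iff) simp
  qed
  have 2: "(\<lambda>n. l * (c n * s ^ n)) sums (l * hsol a b l s)"
    unfolding hsol_def c_def by (intro sums_mult summable_sums summable_hcoeff)
  have 3: "real n * c n * s ^ n - l * (c n * s ^ n) = diffs (diffs c) n * s ^ n" for n
  proof -
    have "diffs (diffs c) n = (real n - l) * c n"
      using hcoeff_rec[of n a b l] by (simp add: diffs_def c_def add.commute del: hcoeff.simps)
    then show ?thesis by (simp only:) (simp add: algebra_simps)
  qed
  have "(\<lambda>n. diffs (diffs c) n * s ^ n) sums (s * hsol b (- l * a) (l - 1) s - l * hsol a b l s)"
    using sums_diff[OF 1 2] unfolding 3 .
  then show ?thesis
    unfolding c_def hcoeff_diffs hsol_def[of "- l * a"] by (metis sums_unique)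
qed

section \<open>Joint continuity in the parameter and the point\<close>

lemma continuous_on_hcoeff: "continuous_on A (\<lambda>l. hcoeff a b l n)"
  by (induction n rule: nat_induct2) (auto intro!: continuous_intros simp: numeral_2_eq_2)

lemma continuous_on_hsol_compact:
  "continuous_on ({- L..L} \<times> {- r..r}) (\<lambda>(l, s). hsol a b l s)"
proof -
  have "uniform_limit ({- L..L} \<times> {- r..r})
     (\<lambda>n p. \<Sum>i<n. hcoeff a b (fst p) i * snd p ^ i) (\<lambda>p. \<Sum>i. hcoeff a b (fst p) i * snd p ^ i) sequentially"
  proof (rule Weierstrass_m_test)
    show "norm (hcoeff a b (fst p) n * snd p ^ n) \<le> hcoeff \<bar>a\<bar> \<bar>b\<bar> (- L) n * r ^ n"
      if "p \<in> {- L..L} \<times> {- r..r}" for n p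
    proof -
      have "\<bar>hcoeff a b (fst p) n\<bar> \<le> hcoeff \<bar>a\<bar> \<bar>b\<bar> (- L) n" "\<bar>snd p\<bar> ^ n \<le> r ^ n" 
        using that by (auto intro!: hcoeff_majorant power_mono)
      then show ?thesis
        unfolding real_norm_def abs_mult power_abs by (intro mult_mono) auto
    qed
  qed (rule summable_hcoeff)
  then have "continuous_on ({- L..L} \<times> {- r..r}) (\<lambda>p. \<Sum>i. hcoeff a b (fst p) i * snd p ^ i)"
    by (rule uniform_limit_theorem[rotated])
      (auto intro!: always_eventually continuous_intros continuous_on_compose2[OF continuous_on_hcoeff[of UNIV]])
  then show ?thesis by (simp add: hsol_def case_prod_unfold)
qed

lemma continuous_on_hsol: "continuous_on UNIV (\<lambda>(l, s). hsol a b l s)"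
proof -
  have "isCont (\<lambda>(l, s). hsol a b l s) (l, s)" for l s
  proof (rule continuous_on_interior[OF continuous_on_hsol_compact])
    show "(l, s) \<in> interior ({- (\<bar>l\<bar> + 1)..\<bar>l\<bar> + 1} \<times> {- (\<bar>s\<bar> + 1)..\<bar>s\<bar> + 1})"
      by (auto simp: interior_Times)
  qed
  then show ?thesis by (auto simp: continuous_on_eq_continuous_at)
qed

lemma continuous_on_hsol_compose [continuous_intros]:
  assumes "continuous_on A f" "continuous_on A g"
  shows "continuous_on A (\<lambda>x. hsol a b (f x) (g x))"
  using continuous_on_compose2[OF continuous_on_hsol, of A "\<lambda>x. (f x, g x)" a b] assms
  by (auto intro: continuous_on_Pair)

lemma hsol_even: "hsol a 0 l (- s) = hsol a 0 l s"
proof -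
  have "hcoeff a 0 l n * (- s) ^ n = hcoeff a 0 l n * s ^ n" for n
    by (cases "even n") (auto elim!: oddE simp: hcoeff_even)
  then show ?thesis by (simp only: hsol_def)
qed

lemma hsol_odd: "hsol 0 b l (- s) = - hsol 0 b l s"
proof -
  have "hcoeff 0 b l n * (- s) ^ n = - (hcoeff 0 b l n * s ^ n)" for n
    by (cases "even n") (auto elim!: evenE simp: hcoeff_odd)
  then show ?thesis by (simp only: hsol_def suminf_minus summable_hcoeff)
qed

lemma hsol_scale: "hsol (c * a) (c * b) l s = c * hsol a b l s"
proof -
  have "hcoeff (c * a) (c * b) l n = c * hcoeff a b l n" for n
    by (induction a b l n rule: hcoeff.induct) auto
  then show ?thesis by (simp add: hsol_def suminf_mult summable_hcoeff mult.assoc)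
qed

text \<open>For \<open>l \<le> 0\<close> all coefficients are nonnegative, so the series is at least
  its first two terms. In particular every eigenvalue is positive.\<close>

lemma hsol_pos_of_nonpos:
  assumes "a \<ge> 0" "b \<ge> 0" "l \<le> 0" "s > 0" "a + b > 0"
  shows "hsol a b l s > 0"
proof -
  have "(\<Sum>n<2. hcoeff a b l n * s ^ n) \<le> hsol a b l s"
    unfolding hsol_def
    by (rule sum_le_suminf) (use assms in \<open>auto intro!: summable_hcoeff mult_nonneg_nonneg hcoeff_nonneg\<close>)
  moreover have "(\<Sum>n<2. hcoeff a b l n * s ^ n) = a + b * s"
    by (simp add: numeral_2_eq_2)
  moreover have "a + b * s > 0" 
    using assms by (cases "b = 0") (auto intro!: add_nonneg_pos)
  ultimately show ?thesis by linarith
qed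


section \<open>Eigenvalues and Wronskians\<close>

declare hsol_deriv [derivative_intros]

text \<open>Abel's identity: the Wronskian of two solutions satisfies W' = s W, so multiplying it by
  \<open>exp (- (s\<^sup>2 / 2))\<close> gives a constant.\<close>

lemma ode_wronskian:
  assumes "\<And>s. s \<in> {- r<..<r} \<Longrightarrow> (u has_real_derivative u' s) (at s)"
    and "\<And>s. s \<in> {- r<..<r} \<Longrightarrow> (u' has_real_derivative u'' s) (at s)"
    and "\<And>s. s \<in> {- r<..<r} \<Longrightarrow> - u'' s + s * u' s = l * u s"
    and s: "s \<in> {- r<..<r}"
  shows "u' s * hsol a b l s - u s * hsol b (- l * a) (l - 1) s = (u' 0 * a - u 0 * b) * exp (s\<^sup>2 / 2)"
proof -
  define W where "W = (\<lambda>s. (u' s * hsol a b l s - u s * hsol b (- l * a) (l - 1) s) * exp (- (s\<^sup>2 / 2)))"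
  have "\<exists>c. \<forall>x\<in>{- r<..<r}. W x = c"
  proof (rule has_field_derivative_zero_constant)
    fix x assume x: "x \<in> {- r<..<r}"
    have eq: "u'' x = x * u' x - l * u x" using assms(3)[OF x] by simp
    have e: "((\<lambda>s. exp (- (s\<^sup>2 / 2))) has_real_derivative - x * exp (- (x\<^sup>2 / 2))) (at x)"
      by (auto intro!: derivative_eq_intros)
    have "(W has_real_derivative 0) (at x)"
      unfolding W_def
      by (rule DERIV_cong, (rule derivative_intros e assms(1,2)[OF x])+, unfold eq hsol_ode)
        (simp add: algebra_simps)
    then show "(W has_real_derivative 0) (at x within {- r<..<r})"
      by (rule has_field_derivative_at_within)
  qed simp
  moreover have "0 \<in> {- r<..<r}" using s by auto
  ultimately have "W s = W 0" using s by metis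
  then show ?thesis
    by (simp add: W_def hsol_0 exp_minus field_simps)
qed

lemma hsol_eigen_ode:
  "- hsol (- l * a) (- (l - 1) * b) (l - 1 - 1) s + s * hsol b (- l * a) (l - 1) s = l * hsol a b l s"
  by (simp only: hsol_ode)

text \<open>Uniqueness for the initial value problem by Cramer's rule: the Wronskians of
  \<open>u\<close> with the even and the odd solution are known, and the Wronskian of these two
  never vanishes.\<close>

lemma ode_solution_eq:
  assumes u: "\<And>s. s \<in> {- r<..<r} \<Longrightarrow> (u has_real_derivative u' s) (at s)"
    "\<And>s. s \<in> {- r<..<r} \<Longrightarrow> (u' has_real_derivative u'' s) (at s)"
    "\<And>s. s \<in> {- r<..<r} \<Longrightarrow> - u'' s + s * u' s = l * u s"
    and s: "s \<in> {- r<..<r}"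
  shows "u s = u 0 * hsol 1 0 l s + u' 0 * hsol 0 1 l s"
proof -
  let ?e = "exp (s\<^sup>2 / 2)"
  let ?E = "hsol 1 0 l s" and ?E' = "hsol 0 (- l * 1) (l - 1) s"
  let ?O = "hsol 0 1 l s" and ?O' = "hsol 1 (- l * 0) (l - 1) s"
  have 1: "u' s * ?E - u s * ?E' = u' 0 * ?e"
    using ode_wronskian[OF u s, of 1 0] by simp
  have 2: "u' s * ?O - u s * ?O' = - u 0 * ?e"
    using ode_wronskian[OF u s, of 0 1] by simp
  have 3: "?E' * ?O - ?E * ?O' = - ?e"
    using ode_wronskian[of r "hsol 1 0 l" "hsol 0 (- l * 1) (l - 1)" "hsol (- l * 1) (- (l - 1) * 0) (l - 1 - 1)" l s 0 1,
        OF hsol_deriv hsol_deriv hsol_eigen_ode s] by (simp add: hsol_0)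
  have "u s * ?e = u s * (?E * ?O' - ?E' * ?O)" using 3 by simp
  also have "\<dots> = (u' s * ?E - u s * ?E') * ?O - (u' s * ?O - u s * ?O') * ?E"
    by (simp add: algebra_simps)
  also have "\<dots> = (u 0 * ?E + u' 0 * ?O) * ?e" unfolding 1 2 by (simp add: algebra_simps)
  finally show ?thesis by simp
qed

lemma dirichlet_eigenfunction_hsol:
  assumes "D > 0" "hsol a b l (D/2) = 0" "hsol a b l (- D/2) = 0" "a \<noteq> 0 \<or> b \<noteq> 0"
  shows "dirichlet_eigenfunction D l (hsol a b l)"
proof -
  have "\<exists>s\<in>{- D/2<..<D/2}. hsol a b l s \<noteq> 0"
  proof (rule ccontr)
    assume "\<not> ?thesis"
    then have z: "hsol a b l s = 0" if "s \<in> {- D/2<..<D/2}" for s using that by blast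
    have "a = 0" using z[of 0] \<open>D > 0\<close> by (simp add: hsol_0)
    moreover have "(hsol a b l has_real_derivative 0) (at 0)"
      by (rule has_field_derivative_transform_within_open[OF DERIV_const, where S="{- D/2<..<D/2}"])
        (use z \<open>D > 0\<close> in auto)
    then have "b = 0" using DERIV_unique hsol_deriv hsol_0 by metis
    ultimately show False using assms(4) by blast
  qed
  moreover have "\<exists>u' u''. \<forall>s\<in>{- D/2<..<D/2}. (hsol a b l has_real_derivative u' s) (at s) \<and>
        (u' has_real_derivative u'' s) (at s) \<and> - u'' s + s * u' s = l * hsol a b l s"
    using hsol_deriv hsol_eigen_ode by blast
  ultimately show ?thesis
    using assms unfolding dirichlet_eigenfunction_def by (auto intro!: continuous_intros)
qed

text \<open>Every solution combines the even and the odd one. Adding and subtracting the conditions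
  at the two end points separates the parities, and one of the two coefficients is nonzero.\<close>

lemma is_dirichlet_eigenvalue_iff:
  assumes "D > 0"
  shows "is_dirichlet_eigenvalue D l \<longleftrightarrow> hsol 1 0 l (D/2) = 0 \<or> hsol 0 1 l (D/2) = 0"
proof
  assume "is_dirichlet_eigenvalue D l"
  then obtain u u' u'' where u: "continuous_on {-D/2..D/2} u" "u (-D/2) = 0" "u (D/2) = 0"
      "\<exists>s\<in>{-D/2<..<D/2}. u s \<noteq> 0"
    and ode: "\<And>s. s \<in> {-D/2<..<D/2} \<Longrightarrow> (u has_real_derivative u' s) (at s)"
      "\<And>s. s \<in> {-D/2<..<D/2} \<Longrightarrow> (u' has_real_derivative u'' s) (at s)"
      "\<And>s. s \<in> {-D/2<..<D/2} \<Longrightarrow> - u'' s + s * u' s = l * u s"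
    unfolding is_dirichlet_eigenvalue_def dirichlet_eigenfunction_def by blast
  \<comment> \<open>The equation is only given in the open interval; continuity of \<open>z\<close>
    carries the representation of \<open>u\<close> to the end points.\<close>
  define z where "z = (\<lambda>s. u s - (u 0 * hsol 1 0 l s + u' 0 * hsol 0 1 l s))"
  have z: "z s = 0" if "s \<in> {-D/2<..<D/2}" for s
    using ode_solution_eq[of "D/2" u u' u'' l s] ode that by (simp add: z_def)
  have cl: "closure {-D/2<..<D/2} = {-D/2..D/2}" using assms by simp
  have zc: "continuous_on (closure {-D/2<..<D/2}) z"
    unfolding cl z_def by (intro continuous_intros u(1))
  have "z s = 0" if "s \<in> {-D/2..D/2}" for s
    by (rule continuous_constant_on_closure[OF zc z]) (use that in \<open>simp_all only: cl\<close>)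
  then have z_end: "z (D/2) = 0" "z (-D/2) = 0" using assms by simp_all
  have par: "hsol 1 0 l (-D/2) = hsol 1 0 l (D/2)" "hsol 0 1 l (-D/2) = - hsol 0 1 l (D/2)"
    using hsol_even[of 1 l "D/2"] hsol_odd[of 1 l "D/2"] by simp_all
  have "0 - (u 0 * hsol 1 0 l (D/2) + u' 0 * hsol 0 1 l (D/2)) = 0"
    "0 - (u 0 * hsol 1 0 l (D/2) + u' 0 * - hsol 0 1 l (D/2)) = 0"
    using z_end unfolding z_def u(2,3) par .
  then have "u 0 * hsol 1 0 l (D/2) = 0" "u' 0 * hsol 0 1 l (D/2) = 0" by linarith+
  moreover have "u 0 \<noteq> 0 \<or> u' 0 \<noteq> 0"
  proof (rule ccontr)
    assume "\<not> ?thesis"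
    then have "z = u" by (simp add: z_def)
    then show False using u(4) z by metis
  qed
  ultimately show "hsol 1 0 l (D/2) = 0 \<or> hsol 0 1 l (D/2) = 0" by auto
next
  assume "hsol 1 0 l (D/2) = 0 \<or> hsol 0 1 l (D/2) = 0"
  then show "is_dirichlet_eigenvalue D l"
    unfolding is_dirichlet_eigenvalue_def
    using dirichlet_eigenfunction_hsol[OF assms, of 1 0 l] dirichlet_eigenfunction_hsol[OF assms, of 0 1 l]
      hsol_even[of 1 l "D/2"] hsol_odd[of 1 l "D/2"] by auto
qed

section \<open>Oscillator form on the unit interval and Green's identity\<close>

definition osc :: "real \<Rightarrow> real \<Rightarrow> (real \<Rightarrow> real) \<Rightarrow> (real \<Rightarrow> real) \<Rightarrow> bool" where
  "osc t m v v' \<longleftrightarrow> (\<forall>x. (v has_real_derivative v' x) (at x) \<and>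
     (v' has_real_derivative (t * x\<^sup>2 - m) * v x) (at x))"

lemma oscD:
  assumes "osc t m v v'"
  shows "(v has_real_derivative v' x) (at x)" "(v' has_real_derivative (t * x\<^sup>2 - m) * v x) (at x)"
  using assms by (auto simp: osc_def)

lemma osc_continuous: "osc t m v v' \<Longrightarrow> continuous_on A v"
  by (meson oscD(1) DERIV_isCont continuous_at_imp_continuous_on)

text \<open>The exponential is the square root of the weight that makes the operator symmetric, and
  it removes the first-order term. Being positive, it preserves zeros and signs.\<close>

definition scaled :: "real \<Rightarrow> real \<Rightarrow> real \<Rightarrow> real \<Rightarrow> real \<Rightarrow> real" where
  "scaled a b l R x = hsol a b l (R * x) * exp (- (R * x)\<^sup>2 / 4)"

definition scaled' :: "real \<Rightarrow> real \<Rightarrow> real \<Rightarrow> real \<Rightarrow> real \<Rightarrow> real" where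
  "scaled' a b l R x = R * (hsol b (- l * a) (l - 1) (R * x) - R * x / 2 * hsol a b l (R * x))
     * exp (- (R * x)\<^sup>2 / 4)"

text \<open>In \<open>s = R * x\<close> the Gaussian factor produces the potential
  \<open>s\<^sup>2 / 4\<close> and shifts \<open>l\<close> by 1/2; the two derivatives contribute
  the factor \<open>R\<^sup>2\<close>.\<close>

lemma osc_scaled: "osc (R ^ 4 / 4) (R\<^sup>2 * (l + 1/2)) (scaled a b l R) (scaled' a b l R)"
  unfolding osc_def
proof (intro allI conjI)
  fix x
  have e: "((\<lambda>x. exp (- (R * x)\<^sup>2 / 4)) has_real_derivative - (R\<^sup>2 * x / 2) * exp (- (R * x)\<^sup>2 / 4)) (at x)"
    by (auto intro!: derivative_eq_intros simp: power2_eq_square)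
  have h: "((\<lambda>x. hsol a b l (R * x)) has_real_derivative R * hsol b (- l * a) (l - 1) (R * x)) (at x)" for a b l
    by (rule DERIV_cong[OF DERIV_chain2[OF hsol_deriv DERIV_cmult_Id[of R]]]) simp
  show "(scaled a b l R has_real_derivative scaled' a b l R x) (at x)"
    unfolding scaled_def scaled'_def
    by (rule DERIV_cong[OF DERIV_mult[OF h e]]) (simp add: algebra_simps power2_eq_square)
  have q: "((\<lambda>x. R * x / 2) has_real_derivative R / 2) (at x)"
    by (auto intro!: derivative_eq_intros)
  note h' = DERIV_cmult[OF DERIV_diff[OF h DERIV_mult[OF q h]], of R b "- l * a" "l - 1" a b l]
  show "(scaled' a b l R has_real_derivative (R ^ 4 / 4 * x\<^sup>2 - R\<^sup>2 * (l + 1/2)) * scaled a b l R x) (at x)"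
    unfolding scaled_def scaled'_def
    by (rule DERIV_cong[OF DERIV_mult[OF h' e]], unfold hsol_ode)
      (simp add: field_simps power2_eq_square power4_eq_xxxx)
qed

lemma wronskian_deriv:
  assumes "osc t m v v'" "osc s k w w'"
  shows "((\<lambda>x. v' x * w x - v x * w' x) has_real_derivative
            ((t - s) * x\<^sup>2 - (m - k)) * (v x * w x)) (at x)"
  by (rule derivative_eq_intros refl oscD[OF assms(1)] oscD[OF assms(2)])+ (simp add: algebra_simps)

lemma wronskian_integral:
  assumes "osc t m v v'" "osc s k w w'"
  shows "((\<lambda>x. ((t - s) * x\<^sup>2 - (m - k)) * (v x * w x)) has_integral
           (v' 1 * w 1 - v 1 * w' 1) - (v' 0 * w 0 - v 0 * w' 0)) {0..1}"
  by (rule fundamental_theorem_of_calculus)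
    (auto intro!: has_field_derivative_at_within wronskian_deriv[OF assms]
       simp flip: has_real_derivative_iff_has_vector_derivative)

lemma wronskian_const:
  assumes "osc t m v v'" "osc t m w w'"
  shows "v' x * w x - v x * w' x = v' 0 * w 0 - v 0 * w' 0"
proof -
  have "\<forall>x. ((\<lambda>x. v' x * w x - v x * w' x) has_real_derivative 0) (at x)"
    using wronskian_deriv[OF assms] by simp
  from DERIV_isconst_all[OF this] show ?thesis .
qed

lemma has_integral_pos_unit:
  fixes f :: "real \<Rightarrow> real"
  assumes "(f has_integral I) {0..1}" "continuous_on {0..1} f" "\<And>x. 0 < x \<Longrightarrow> x < 1 \<Longrightarrow> f x > 0"
  shows "I > 0"
  using integral_less_real[of 0 1 "\<lambda>_. 0" f] assms by (auto simp: integral_unique)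


section \<open>The first two eigenvalues\<close>

lemma scaled_0: "scaled a b l R 0 = a" "scaled' a b l R 0 = R * b"
  by (simp_all add: scaled_def scaled'_def hsol_0)

lemma scaled_1: "scaled a b l R 1 = hsol a b l R * exp (- R\<^sup>2 / 4)"
  by (simp add: scaled_def)

lemma scaled_pos_iff: "scaled a b l R x > 0 \<longleftrightarrow> hsol a b l (R * x) > 0"
  by (simp add: scaled_def zero_less_mult_iff)

lemma osc_sin: "osc 0 (c\<^sup>2) (\<lambda>x. sin (c * x)) (\<lambda>x. c * cos (c * x))"
  unfolding osc_def by (auto intro!: derivative_eq_intros simp: power2_eq_square)

lemma osc_cos: "osc 0 (c\<^sup>2) (\<lambda>x. cos (c * x)) (\<lambda>x. - c * sin (c * x))"
  unfolding osc_def by (auto intro!: derivative_eq_intros simp: power2_eq_square)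

text \<open>The boundary terms of Green's identity vanish: at 1 by the Dirichlet conditions, at 0 by
  the assumption on the initial values, which holds for functions of equal parity. The strict
  inequality between the integrals comes from \<open>x\<^sup>2 < 1\<close>.\<close>

lemma osc_compare:
  assumes "osc t m v v'" "osc s k w w'" "v 1 = 0" "w 1 = 0" "v' 0 * w 0 = v 0 * w' 0"
    and pos: "\<And>x. 0 < x \<Longrightarrow> x < 1 \<Longrightarrow> v x > 0" "\<And>x. 0 < x \<Longrightarrow> x < 1 \<Longrightarrow> w x > 0"
  shows "(m - k) * integral {0..1} (\<lambda>x. v x * w x) = (t - s) * integral {0..1} (\<lambda>x. x\<^sup>2 * (v x * w x))"
    and "0 < integral {0..1} (\<lambda>x. x\<^sup>2 * (v x * w x))"
    and "integral {0..1} (\<lambda>x. x\<^sup>2 * (v x * w x)) < integral {0..1} (\<lambda>x. v x * w x)"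
proof -
  note [continuous_intros] = osc_continuous[OF assms(1)] osc_continuous[OF assms(2)]
  have c: "continuous_on {0..1} (\<lambda>x. v x * w x)" "continuous_on {0..1} (\<lambda>x. x\<^sup>2 * (v x * w x))"
    by (intro continuous_intros)+
  have "((\<lambda>x. ((t - s) * x\<^sup>2 - (m - k)) * (v x * w x)) has_integral 0) {0..1}"
    using wronskian_integral[OF assms(1,2)] assms by simp
  also have "(\<lambda>x. ((t - s) * x\<^sup>2 - (m - k)) * (v x * w x))
      = (\<lambda>x. (t - s) * (x\<^sup>2 * (v x * w x)) - (m - k) * (v x * w x))"
    by (simp add: algebra_simps)
  finally have A: "((\<lambda>x. (t - s) * (x\<^sup>2 * (v x * w x)) - (m - k) * (v x * w x)) has_integral 0) {0..1}" .
  have B: "((\<lambda>x. (t - s) * (x\<^sup>2 * (v x * w x)) - (m - k) * (v x * w x)) has_integral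
     (t - s) * integral {0..1} (\<lambda>x. x\<^sup>2 * (v x * w x)) - (m - k) * integral {0..1} (\<lambda>x. v x * w x)) {0..1}"
    by (intro has_integral_diff has_integral_mult_right integrable_integral integrable_continuous_real c)
  show "(m - k) * integral {0..1} (\<lambda>x. v x * w x) = (t - s) * integral {0..1} (\<lambda>x. x\<^sup>2 * (v x * w x))"
    using has_integral_unique[OF A B] by simp
  show "0 < integral {0..1} (\<lambda>x. x\<^sup>2 * (v x * w x))"
    by (rule has_integral_pos_unit[OF integrable_integral]) (auto intro!: integrable_continuous_real c mult_pos_pos pos)
  show "integral {0..1} (\<lambda>x. x\<^sup>2 * (v x * w x)) < integral {0..1} (\<lambda>x. v x * w x)"
  proof (rule integral_less_real[OF c(2,1)])
    show "x\<^sup>2 * (v x * w x) < v x * w x" if "x \<in> {0<..<1}" for x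
      using that pos[of x] by (simp add: power_less_one_iff)
  qed auto
qed

text \<open>Dividing by the positive integral of \<open>v x * w x\<close> gives
  \<open>m - k = q * (t - s)\<close> with \<open>0 < q < 1\<close>. For \<open>s = t\<close> this
  says that positive eigenfunctions with matching data at 0 share their eigenvalue.\<close>

lemma osc_eigenvalue_mono:
  assumes "osc t m v v'" "osc s k w w'" "v 1 = 0" "w 1 = 0" "v' 0 * w 0 = v 0 * w' 0"
    and pos: "\<And>x. 0 < x \<Longrightarrow> x < 1 \<Longrightarrow> v x > 0" "\<And>x. 0 < x \<Longrightarrow> x < 1 \<Longrightarrow> w x > 0"
    and "s \<le> t"
  shows "0 \<le> m - k" "m - k \<le> t - s"
proof -
  let ?J = "integral {0..1} (\<lambda>x. x\<^sup>2 * (v x * w x))" and ?I = "integral {0..1} (\<lambda>x. v x * w x)"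
  have eq: "(m - k) * ?I = (t - s) * ?J" and J: "0 < ?J" and JI: "?J < ?I"
    by (rule osc_compare[OF assms(1-5) pos]; assumption)+
  then have I: "0 < ?I" by linarith
  have "0 \<le> (m - k) * ?I" unfolding eq using \<open>s \<le> t\<close> J by simp
  then show "0 \<le> m - k" using I by (simp add: zero_le_mult_iff)
  have "(m - k) * ?I \<le> (t - s) * ?I" unfolding eq using \<open>s \<le> t\<close> JI by (intro mult_left_mono) auto
  then show "m - k \<le> t - s" using I by simp
qed

lemma hsol_odd_deriv: "(hsol 0 1 l has_real_derivative hsol 1 0 (l - 1) s) (at s)"
  using hsol_deriv[of 0 1 l s] by simp

text \<open>Through this link, positivity of odd solutions controls the monotonicity of even
  ones.\<close>

lemma hsol_even_deriv: "(hsol 1 0 l has_real_derivative - l * hsol 0 1 (l - 1) s) (at s)"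
  using hsol_deriv[of 1 0 l s] hsol_scale[of "- l" 0 1 "l - 1" s] by simp

lemma hsol_odd_pos:
  assumes "\<And>s. s \<in> {0<..r} \<Longrightarrow> hsol 0 1 l s \<noteq> 0" "s \<in> {0<..r}"
  shows "hsol 0 1 l s > 0"
proof (rule ccontr)
  assume neg: "\<not> ?thesis"
  obtain d where d: "d > 0" "\<And>h. 0 < h \<Longrightarrow> h < d \<Longrightarrow> hsol 0 1 l h > 0"
    using DERIV_pos_inc_right[OF hsol_odd_deriv[of l 0]] by (auto simp: hsol_0)
  define h where "h = min (d/2) s"
  have h: "0 < h" "h < d" "h \<le> s" using d assms by (auto simp: h_def)
  have "\<exists>x\<ge>h. x \<le> s \<and> hsol 0 1 l x = 0"
  proof (rule IVT2')
    show "hsol 0 1 l s \<le> 0" using neg by simp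
    show "0 \<le> hsol 0 1 l h" using d(2)[OF h(1,2)] by simp
  qed (use h in \<open>auto intro!: continuous_intros\<close>)
  then show False using assms h by fastforce
qed

text \<open>The derivative is 1 at \<open>s = 0\<close> for every \<open>l\<close>, and uniform
  continuity keeps it positive nearby. This separates the other zeros from the trivial one at 0,
  uniformly in \<open>l\<close>.\<close>

lemma hsol_odd_pos_near_0:
  "\<exists>d>0. \<forall>l\<in>{0..L}. \<forall>s\<in>{0<..<d}. hsol 0 1 l s > 0"
proof -
  have "uniformly_continuous_on ({0..L} \<times> {0..1}) (\<lambda>p. hsol 1 0 (fst p - 1) (snd p))"
    by (intro compact_uniformly_continuous compact_Times continuous_intros) auto
  then obtain d where d: "d > 0"
    "\<And>p q. p \<in> {0..L} \<times> {0..1} \<Longrightarrow> q \<in> {0..L} \<times> {0..1} \<Longrightarrow> dist q p < d \<Longrightarrow>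
       dist (hsol 1 0 (fst q - 1) (snd q)) (hsol 1 0 (fst p - 1) (snd p)) < 1"
    unfolding uniformly_continuous_on_def by (metis zero_less_one)
  have der: "hsol 1 0 (l - 1) s > 0" if "l \<in> {0..L}" "s \<in> {0..<min d 1}" for l s
    using d(2)[of "(l, 0)" "(l, s)"] that by (auto simp: dist_Pair_Pair hsol_0 dist_real_def)
  have "hsol 0 1 l s > 0" if "l \<in> {0..L}" "s \<in> {0<..<min d 1}" for l s
  proof -
    have "hsol 0 1 l 0 < hsol 0 1 l s"
      by (rule DERIV_pos_imp_increasing) (use that in \<open>auto intro!: exI hsol_odd_deriv der\<close>)
    then show ?thesis by (simp add: hsol_0)
  qed
  then show ?thesis using d(1) by (intro exI[of _ "min d 1"]) auto
qed

text \<open>By Sturm comparison with \<open>sin (pi * x)\<close>.\<close>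

lemma hsol_odd_has_zero:
  assumes "R > 0"
  shows "\<exists>l\<ge>0. \<exists>s\<in>{0<..R}. hsol 0 1 l s = 0"
proof (rule ccontr)
  assume neg: "\<not> ?thesis"
  \<comment> \<open>Chosen so that \<open>R\<^sup>2 * (l + 1/2) - pi\<^sup>2\<close> exceeds
    \<open>R ^ 4 / 4 * x\<^sup>2\<close> on the unit interval. Green's identity then gives a
    positive integrand with integral \<open>- (pi * v 1)\<close>, against
    \<open>v 1 > 0\<close>.\<close>
  define l where "l = (R ^ 4 / 4 + pi\<^sup>2 + 1) / R\<^sup>2"
  have "l \<ge> 0" by (auto simp: l_def)
  with neg have "hsol 0 1 l s \<noteq> 0" if "s \<in> {0<..R}" for s using that by blast
  then have pos: "hsol 0 1 l s > 0" if "s \<in> {0<..R}" for s using that hsol_odd_pos by blast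
  define v where "v = scaled 0 1 l R"
  have v: "v x > 0" if "0 < x" "x \<le> 1" for x
    unfolding v_def scaled_pos_iff by (rule pos) (use that assms mult_left_le in auto)
  have "R\<^sup>2 * l = R ^ 4 / 4 + pi\<^sup>2 + 1" using assms by (simp add: l_def)
  then have m: "R\<^sup>2 * (l + 1/2) > R ^ 4 / 4 + pi\<^sup>2"
    unfolding distrib_left using zero_le_power2[of R] by linarith
  have os: "osc (R ^ 4 / 4) (R\<^sup>2 * (l + 1/2)) v (scaled' 0 1 l R)"
    unfolding v_def by (rule osc_scaled)
  have "((\<lambda>x. (R\<^sup>2 * (l + 1/2) - pi\<^sup>2 - R ^ 4 / 4 * x\<^sup>2) * (v x * sin (pi * x))) has_integral - (pi * v 1)) {0..1}"
    using has_integral_neg[OF wronskian_integral[OF os osc_sin[of pi]]]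
    by (simp add: v_def scaled_0 algebra_simps)
  then have "- (pi * v 1) > 0"
  proof (rule has_integral_pos_unit)
    show "continuous_on {0..1} (\<lambda>x. (R\<^sup>2 * (l + 1/2) - pi\<^sup>2 - R ^ 4 / 4 * x\<^sup>2) * (v x * sin (pi * x)))"
      by (intro continuous_intros osc_continuous[OF os])
    fix x :: real assume x: "0 < x" "x < 1"
    have "x\<^sup>2 \<le> 1" using x by (simp add: power_le_one)
    then have "R ^ 4 / 4 * x\<^sup>2 \<le> R ^ 4 / 4" by (intro mult_left_le) auto
    then have "R\<^sup>2 * (l + 1/2) - pi\<^sup>2 - R ^ 4 / 4 * x\<^sup>2 > 0" using m by linarith
    moreover have "sin (pi * x) > 0" by (rule sin_gt_zero) (use x in auto)
    ultimately show "(R\<^sup>2 * (l + 1/2) - pi\<^sup>2 - R ^ 4 / 4 * x\<^sup>2) * (v x * sin (pi * x)) > 0"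
      using v x by simp
  qed
  then show False using v[of 1] by (simp add: mult_less_0_iff)
qed

text \<open>\<open>l\<close> is the least parameter at which the odd solution has a zero in
  \<open>{0<..R}\<close>. As a limit from smaller parameters this solution is nonnegative, so an
  interior zero would be double, which is impossible; the zero sits at \<open>R\<close>.\<close>

lemma second_eigenvalue_exists:
  assumes "R > 0"
  obtains l where "l > 0" "hsol 0 1 l R = 0" "\<And>s. s \<in> {0<..<R} \<Longrightarrow> hsol 0 1 l s > 0"
    "\<And>k s. k < l \<Longrightarrow> s \<in> {0<..R} \<Longrightarrow> hsol 0 1 k s > 0"
proof -
  obtain L s0 where L: "L \<ge> 0" "s0 \<in> {0<..R}" "hsol 0 1 L s0 = 0"
    using hsol_odd_has_zero[OF assms] by blast
  obtain d where d: "d > 0" "\<And>l s. l \<in> {0..L} \<Longrightarrow> s \<in> {0<..<d} \<Longrightarrow> hsol 0 1 l s > 0"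
    using hsol_odd_pos_near_0[of L] by blast
  \<comment> \<open>Cutting off at \<open>d\<close> loses no zero and makes the zero set compact, so
    a least parameter is attained.\<close>
  define K where "K = {p \<in> {0..L} \<times> {d..R}. hsol 0 1 (fst p) (snd p) = 0}"
  have K: "(l, s) \<in> K" if "l \<in> {0..L}" "s \<in> {0<..R}" "hsol 0 1 l s = 0" for l s
    using that d(2)[of l s] by (force simp: K_def)
  have cK: "compact K"
  proof -
    have "closed K"
      unfolding K_def
      by (intro continuous_closed_preimage_constant continuous_intros closed_Times)
    moreover have "K \<subseteq> {0..L} \<times> {d..R}" by (auto simp: K_def)
    ultimately show ?thesis
      using compact_Int_closed[of "{0..L} \<times> {d..R}" K] by (simp add: compact_Times inf.absorb2)
  qed
  have "K \<noteq> {}" using K[of L s0] L by auto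
  then obtain p where p: "p \<in> K" "\<And>q. q \<in> K \<Longrightarrow> fst p \<le> fst q"
    using continuous_attains_inf[OF cK _ continuous_on_fst[OF continuous_on_id]] by metis
  obtain l r where lr: "p = (l, r)" by (cases p)
  have l: "l \<in> {0..L}" "r \<in> {0<..R}" "hsol 0 1 l r = 0" using p(1) d(1) by (auto simp: K_def lr)
  have below: "hsol 0 1 k s > 0" if "k < l" "s \<in> {0<..R}" for k s
  proof (cases "k \<le> 0")
    case True
    then show ?thesis using that by (intro hsol_pos_of_nonpos) auto
  next
    case False
    show ?thesis
    proof (rule hsol_odd_pos[OF _ that(2)])
      show "hsol 0 1 k s \<noteq> 0" if "s \<in> {0<..R}" for s
        using K[of k s] p(2)[of "(k, s)"] that False \<open>k < l\<close> l by (auto simp: lr)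
    qed
  qed
  have "l > 0"
  proof (rule ccontr)
    assume "\<not> l > 0"
    then have "hsol 0 1 l r > 0" using l by (intro hsol_pos_of_nonpos) auto
    then show False using l by simp
  qed
  have nonneg: "hsol 0 1 l s \<ge> 0" if "s \<in> {0<..R}" for s
  proof (rule tendsto_lowerbound)
    have "continuous_on UNIV (\<lambda>l. hsol 0 1 l s)" by (intro continuous_intros)
    then have "isCont (\<lambda>l. hsol 0 1 l s) l" by (simp add: continuous_on_eq_continuous_at)
    then have "((\<lambda>l. hsol 0 1 l s) \<longlongrightarrow> hsol 0 1 l s) (at l)" by (simp add: isCont_def)
    then show "((\<lambda>l. hsol 0 1 l s) \<longlongrightarrow> hsol 0 1 l s) (at_left l)"
      by (rule filterlim_mono) (auto simp: at_le)
    show "\<forall>\<^sub>F k in at_left l. 0 \<le> hsol 0 1 k s"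
      unfolding eventually_at_left_field using below that
      by (intro exI[of _ "l - 1"]) (auto intro: less_imp_le)
  qed simp
  have pos: "hsol 0 1 l s > 0" if s: "s \<in> {0<..<R}" for s
  proof (rule ccontr)
    assume "\<not> ?thesis"
    then have z: "hsol 0 1 l s = 0" using nonneg[of s] s by auto
    \<comment> \<open>The zero is an interior minimum, so the derivative vanishes as well. Then the
      Wronskian of the scaled odd and even solutions would be 0 there, although it is constantly
      \<open>R\<close>.\<close>
    have "hsol 1 0 (l - 1) s = 0"
    proof (rule DERIV_local_min[OF hsol_odd_deriv])
      show "0 < min s (R - s)" using s by auto
      show "\<forall>y. \<bar>s - y\<bar> < min s (R - s) \<longrightarrow> hsol 0 1 l s \<le> hsol 0 1 l y"
        using nonneg z by (auto simp: abs_if split: if_splits)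
    qed
    then have "scaled 0 1 l R (s / R) = 0" "scaled' 0 1 l R (s / R) = 0"
      using z assms by (simp_all add: scaled_def scaled'_def)
    with wronskian_const[OF osc_scaled osc_scaled, of 0 1 l R "s / R" 1 0]
    show False using assms by (simp add: scaled_0)
  qed
  moreover have "hsol 0 1 l R = 0" using pos[of r] l by (cases "r = R") auto
  ultimately show ?thesis using \<open>l > 0\<close> below that by blast
qed

lemma hsol_even_strict_antimono:
  assumes l: "\<And>k s. k < l \<Longrightarrow> s \<in> {0<..R} \<Longrightarrow> hsol 0 1 k s > 0"
    and "0 < j" "j \<le> l" "0 \<le> x" "x < y" "y \<le> R"
  shows "hsol 1 0 j y < hsol 1 0 j x"
proof (rule DERIV_neg_imp_decreasing_open[OF \<open>x < y\<close>])
  show "\<exists>d. (hsol 1 0 j has_real_derivative d) (at s) \<and> d < 0" if "x < s" "s < y" for s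
  proof (intro exI conjI)
    show "(hsol 1 0 j has_real_derivative - j * hsol 0 1 (j - 1) s) (at s)" by (rule hsol_even_deriv)
    show "- j * hsol 0 1 (j - 1) s < 0" using l[of "j - 1" s] assms that by simp
  qed
qed (auto intro!: continuous_intros)

text \<open>At \<open>R\<close> the even solution is positive for parameter 0 and negative for
  \<open>l\<close>; the intermediate value theorem in the parameter gives \<open>k\<close>. An even
  solution that vanishes at \<open>R\<close> with parameter up to \<open>l\<close> decreases to this
  zero, hence is positive before it, and comparison at equal \<open>t\<close> leaves only one such
  parameter.\<close>

lemma first_eigenvalue_exists:
  assumes "R > 0" "l > 0" "hsol 0 1 l R = 0" "\<And>s. s \<in> {0<..<R} \<Longrightarrow> hsol 0 1 l s > 0"
    and below: "\<And>k s. k < l \<Longrightarrow> s \<in> {0<..R} \<Longrightarrow> hsol 0 1 k s > 0"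
  obtains k where "0 < k" "k < l" "hsol 1 0 k R = 0" "\<And>s. s \<in> {0..<R} \<Longrightarrow> hsol 1 0 k s > 0"
    "\<And>j. j \<le> l \<Longrightarrow> hsol 1 0 j R = 0 \<Longrightarrow> j = k"
proof -
  have "scaled' 0 1 l R 1 \<le> 0"
  proof (rule ccontr)
    assume "\<not> ?thesis"
    then obtain d where d: "d > 0" "\<And>h. 0 < h \<Longrightarrow> h < d \<Longrightarrow> scaled 0 1 l R (1 - h) < scaled 0 1 l R 1"
      using DERIV_pos_inc_left[OF oscD(1)[OF osc_scaled]] unfolding not_le by blast
    define h where "h = min (d/2) (1/2)"
    have h: "0 < h" "h < d" "h < 1" using d(1) by (auto simp: h_def)
    have "scaled 0 1 l R (1 - h) > 0"
      unfolding scaled_pos_iff using h assms(1) by (intro assms(4)) auto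
    then show False using d(2)[OF h(1,2)] assms(3) by (simp add: scaled_1)
  qed
  \<comment> \<open>The Wronskian at 1 equals its value \<open>R\<close> at 0. As the slope of the
    odd solution is nonpositive, the even one must be negative.\<close>
  moreover have "scaled' 0 1 l R 1 * scaled 1 0 l R 1 = R"
    using wronskian_const[OF osc_scaled osc_scaled, of 0 1 l R 1 1 0] assms by (simp add: scaled_0 scaled_1)
  ultimately have "scaled 1 0 l R 1 < 0"
    using assms(1) by (smt (verit) mult_nonpos_nonneg)
  then have neg: "hsol 1 0 l R < 0" by (simp add: scaled_1 mult_less_0_iff)
  have "\<exists>k\<ge>0. k \<le> l \<and> hsol 1 0 k R = 0"
    by (rule IVT2') (use neg assms hsol_pos_of_nonpos[of 1 0 0 R] in \<open>auto intro!: continuous_intros\<close>)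
  then obtain k where k: "0 \<le> k" "k \<le> l" "hsol 1 0 k R = 0" by blast
  have gt: "j > 0" if "hsol 1 0 j R = 0" for j
    using hsol_pos_of_nonpos[of 1 0 j R] that assms(1) by (cases "j > 0") auto
  have pos: "hsol 1 0 j s > 0" if "j \<le> l" "hsol 1 0 j R = 0" "s \<in> {0..<R}" for j s
    using hsol_even_strict_antimono[of l R j s R, OF below gt] that by auto
  have "j = k" if "j \<le> l" "hsol 1 0 j R = 0" for j
  proof -
    have j: "scaled 1 0 j R x > 0" if "0 < x" "x < 1" for x
      unfolding scaled_pos_iff by (rule pos) (use that \<open>j \<le> l\<close> \<open>hsol 1 0 j R = 0\<close> assms(1) in auto)
    have k': "scaled 1 0 k R x > 0" if "0 < x" "x < 1" for x
      unfolding scaled_pos_iff by (rule pos) (use that k assms(1) in auto)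
    have "R\<^sup>2 * (j + 1/2) - R\<^sup>2 * (k + 1/2) = 0"
      using osc_eigenvalue_mono[OF osc_scaled osc_scaled _ _ _ j k'] k that
      by (force simp: scaled_0 scaled_1)
    then show ?thesis using assms(1) by simp
  qed
  moreover have "k < l" using k neg by (cases "k = l") auto
  ultimately show ?thesis
    using k(3) by (intro that[of k] gt pos k(2))
qed


section \<open>Dependence on the length of the interval\<close>

lemma has_integral_pos_point:
  fixes f :: "real \<Rightarrow> real"
  assumes "(f has_integral I) {0..1}" "continuous_on {0..1} f" "\<And>x. x \<in> {0..1} \<Longrightarrow> f x \<ge> 0"
    and "x0 \<in> {0..1}" "f x0 > 0"
  shows "I > 0"
proof -
  have "I \<ge> 0" using assms(1,3) by (rule has_integral_nonneg)
  moreover have "integral {0..1} f \<noteq> 0"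
    using integral_eq_0_iff[OF assms(2) _ assms(3)] assms(4,5) by fastforce
  ultimately show ?thesis using assms(1) by (auto simp: integral_unique)
qed

text \<open>The quotient \<open>w / v\<close> increases on \<open>[0, 1)\<close>, so that \<open>w\<^sup>2 / (\<integral> w\<^sup>2) - v\<^sup>2 / (\<integral> v\<^sup>2)\<close> has mean zero
  and changes sign exactly once, at \<open>c\<close>; integrate it against \<open>x\<^sup>2 - c\<^sup>2\<close>.\<close>

lemma second_moment_less:
  assumes v: "osc t m v v'" and w: "osc t k w w'" and "m < k"
    and bc: "v 1 = 0" "w 1 = 0" "w 0 = 0"
    and vpos: "\<And>x. 0 \<le> x \<Longrightarrow> x < 1 \<Longrightarrow> v x > 0" and wpos: "\<And>x. 0 < x \<Longrightarrow> x < 1 \<Longrightarrow> w x > 0"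
  shows "integral {0..1} (\<lambda>x. x\<^sup>2 * (v x * v x)) / integral {0..1} (\<lambda>x. v x * v x)
       < integral {0..1} (\<lambda>x. x\<^sup>2 * (w x * w x)) / integral {0..1} (\<lambda>x. w x * w x)"
proof -
  note [continuous_intros] = osc_continuous[OF v] osc_continuous[OF w]
  define A where "A = integral {0..1} (\<lambda>x. v x * v x)"
  define B where "B = integral {0..1} (\<lambda>x. w x * w x)"
  \<comment> \<open>Up to the factor \<open>A * B\<close> this is the difference of the normalised
    densities, so its mean is zero.\<close>
  define f where "f = (\<lambda>x. A * (w x * w x) - B * (v x * v x))"
  define W where "W = (\<lambda>x. w' x * v x - w x * v' x)"
  have iA: "((\<lambda>x. v x * v x) has_integral A) {0..1}" and iB: "((\<lambda>x. w x * w x) has_integral B) {0..1}"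
    unfolding A_def B_def by (intro integrable_integral integrable_continuous_real continuous_intros)+
  have A: "A > 0" by (rule has_integral_pos_unit[OF iA]) (auto intro!: continuous_intros mult_pos_pos vpos)
  have B: "B > 0" by (rule has_integral_pos_unit[OF iB]) (auto intro!: continuous_intros mult_pos_pos wpos)
  have W': "(W has_real_derivative (m - k) * (w x * v x)) (at x)" for x
    using wronskian_deriv[OF w v] by (simp add: W_def)
  \<comment> \<open>As \<open>m < k\<close>, the Wronskian decreases to \<open>W 1 = 0\<close>. Its
    positivity makes \<open>w / v\<close> increase.\<close>
  have Wpos: "W x > 0" if "0 \<le> x" "x < 1" for x
  proof -
    have "W 1 < W x"
    proof (rule DERIV_neg_imp_decreasing_open[OF \<open>x < 1\<close>])
      show "\<exists>y. (W has_real_derivative y) (at z) \<and> y < 0" if "x < z" "z < 1" for z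
        using W'[of z] vpos[of z] wpos[of z] that \<open>0 \<le> x\<close> \<open>m < k\<close> by (intro exI conjI) (auto simp: mult_neg_pos)
      show "continuous_on {x..1} W"
        by (meson W' DERIV_isCont continuous_at_imp_continuous_on)
    qed
    then show ?thesis by (simp add: W_def bc)
  qed
  have q: "w x / v x < w y / v y" if "0 \<le> x" "x < y" "y < 1" for x y
  proof (rule DERIV_pos_imp_increasing[OF \<open>x < y\<close>])
    fix z assume "x \<le> z" "z \<le> y"
    then have z: "0 \<le> z" "z < 1" using that by auto
    have "((\<lambda>x. w x / v x) has_real_derivative W z / (v z * v z)) (at z)"
      using DERIV_divide[OF oscD(1)[OF w] oscD(1)[OF v], of z] vpos[OF z] by (simp add: W_def)
    moreover have "W z / (v z * v z) > 0" using Wpos[OF z] vpos[OF z] by simp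
    ultimately show "\<exists>d. ((\<lambda>x. w x / v x) has_real_derivative d) (at z) \<and> d > 0" by blast
  qed
  have fc: "continuous_on S f" for S unfolding f_def by (intro continuous_intros)
  have fi: "(f has_integral 0) {0..1}"
    using has_integral_diff[OF has_integral_mult_right[OF iB, of A] has_integral_mult_right[OF iA, of B]]
    by (simp add: f_def mult.commute)
  have f0: "f 0 < 0" using vpos[of 0] B by (simp add: f_def bc)
  have "\<exists>x\<in>{0..1}. f x > 0"
  proof (rule ccontr)
    assume "\<not> ?thesis"
    then have "(0::real) < - 0"
      using f0 by (intro has_integral_pos_point[OF has_integral_neg[OF fi], of 0] continuous_intros fc)
        (auto simp: not_less)
    then show False by simp
  qed
  then obtain x1 where x1: "x1 \<in> {0..1}" "f x1 > 0" by blast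
  have "\<exists>c\<ge>0. c \<le> x1 \<and> f c = 0"
    by (rule IVT') (use x1 f0 in \<open>auto intro: fc\<close>)
  then obtain c where c: "0 \<le> c" "c \<le> x1" "f c = 0" by blast
  have "c \<noteq> 0" "c \<noteq> x1" using c f0 x1 by auto
  then have c01: "0 < c" "c < 1" using c x1 by auto
  \<comment> \<open>\<open>f c = 0\<close> eliminates \<open>B\<close>, so that the sign of
    \<open>f\<close> is governed by the increasing quotient.\<close>
  have fq: "f x = A * (v x)\<^sup>2 * ((w x / v x)\<^sup>2 - (w c / v c)\<^sup>2)" if "0 \<le> x" "x < 1" for x
  proof -
    have "v c \<noteq> 0" "v x \<noteq> 0" using vpos[of c] vpos[of x] c01 that by auto
    moreover have "B = A * (w c / v c)\<^sup>2"
      using c(3) \<open>v c \<noteq> 0\<close> by (simp add: f_def field_simps power2_eq_square)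
    ultimately show ?thesis by (simp add: f_def right_diff_distrib power_divide power2_eq_square mult.assoc)
  qed
  have q0: "0 \<le> w x / v x" if "0 \<le> x" "x < 1" for x
    using vpos[of x] wpos[of x] bc that by (cases "x = 0") (auto intro: less_imp_le)
  have gnn: "(x\<^sup>2 - c\<^sup>2) * f x \<ge> 0" if x: "x \<in> {0..1}" for x
  proof (cases "x = 1")
    case True
    then show ?thesis by (simp add: f_def bc)
  next
    case False
    then have x: "0 \<le> x" "x < 1" using that by auto
    have nn: "(x\<^sup>2 - c\<^sup>2) * ((w x / v x)\<^sup>2 - (w c / v c)\<^sup>2) \<ge> 0"
    proof (cases "x \<le> c")
      case True
      then have "w x / v x \<le> w c / v c" using q[of x c] x c01 by (cases "x = c") (auto intro: less_imp_le)
      then have "(w x / v x)\<^sup>2 \<le> (w c / v c)\<^sup>2" by (rule power_mono[OF _ q0[OF x]])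
      moreover have "x\<^sup>2 \<le> c\<^sup>2" by (rule power_mono[OF True x(1)])
      ultimately show ?thesis by (intro mult_nonpos_nonpos) auto
    next
      case False
      then have "w c / v c \<le> w x / v x" using q[of c x] x c01 by (auto intro: less_imp_le)
      then have "(w c / v c)\<^sup>2 \<le> (w x / v x)\<^sup>2" by (rule power_mono) (use q0[of c] c01 in auto)
      moreover have "c\<^sup>2 \<le> x\<^sup>2" by (rule power_mono) (use False c01 in auto)
      ultimately show ?thesis by (intro mult_nonneg_nonneg) auto
    qed
    have "0 \<le> A * (v x)\<^sup>2" using A by simp
    from mult_nonneg_nonneg[OF this nn]
    have "0 \<le> A * (v x)\<^sup>2 * ((x\<^sup>2 - c\<^sup>2) * ((w x / v x)\<^sup>2 - (w c / v c)\<^sup>2))" .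
    then show ?thesis unfolding fq[OF x] by (simp only: mult_ac)
  qed
  define Mv where "Mv = integral {0..1} (\<lambda>x. x\<^sup>2 * (v x * v x))"
  define Mw where "Mw = integral {0..1} (\<lambda>x. x\<^sup>2 * (w x * w x))"
  have iMv: "((\<lambda>x. x\<^sup>2 * (v x * v x)) has_integral Mv) {0..1}"
    and iMw: "((\<lambda>x. x\<^sup>2 * (w x * w x)) has_integral Mw) {0..1}"
    unfolding Mv_def Mw_def by (intro integrable_integral integrable_continuous_real continuous_intros)+
  \<comment> \<open>Since \<open>f\<close> has mean zero, subtracting \<open>c\<^sup>2 * f x\<close>
    leaves the integral unchanged, while the integrand becomes nonnegative.\<close>
  have "((\<lambda>x. A * (x\<^sup>2 * (w x * w x)) - B * (x\<^sup>2 * (v x * v x)) - c\<^sup>2 * f x) has_integral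
      A * Mw - B * Mv - c\<^sup>2 * 0) {0..1}"
    by (intro has_integral_diff has_integral_mult_right iMv iMw fi)
  also have "(\<lambda>x. A * (x\<^sup>2 * (w x * w x)) - B * (x\<^sup>2 * (v x * v x)) - c\<^sup>2 * f x) = (\<lambda>x. (x\<^sup>2 - c\<^sup>2) * f x)"
    by (simp add: f_def algebra_simps)
  finally have "((\<lambda>x. (x\<^sup>2 - c\<^sup>2) * f x) has_integral A * Mw - B * Mv) {0..1}" by simp
  then have "A * Mw - B * Mv > 0"
  proof (rule has_integral_pos_point[where ?x0.0 = 0])
    show "continuous_on {0..1} (\<lambda>x. (x\<^sup>2 - c\<^sup>2) * f x)" by (intro continuous_intros fc)
    show "0 < (0\<^sup>2 - c\<^sup>2) * f 0" using f0 c01 by (simp add: mult_pos_neg)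
  qed (use gnn in auto)
  then show ?thesis
    unfolding A_def[symmetric] B_def[symmetric] Mv_def[symmetric] Mw_def[symmetric]
    using A B by (simp add: field_simps)
qed

section \<open>Eigenvalue branches: monotonicity, continuity, derivative and limit\<close>

text \<open>\<open>(a, b) = (1, 0)\<close> describes the first and \<open>(a, b) = (0, 1)\<close> the second eigenvalue.\<close>

definition eigen_branch :: "real \<Rightarrow> real \<Rightarrow> (real \<Rightarrow> real) \<Rightarrow> bool" where
  "eigen_branch a b L \<longleftrightarrow> a * b = 0 \<and>
     (\<forall>D>0. hsol a b (L D) (D/2) = 0 \<and> (\<forall>s. 0 < s \<longrightarrow> s < D/2 \<longrightarrow> hsol a b (L D) s > 0))"

lemma eigen_branch_scaled:
  assumes "eigen_branch a b L" "D > 0"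
  shows "scaled a b (L D) (D/2) 1 = 0" "\<And>x. 0 < x \<Longrightarrow> x < 1 \<Longrightarrow> scaled a b (L D) (D/2) x > 0"
  using assms by (auto simp: eigen_branch_def scaled_1 scaled_pos_iff)

text \<open>At 0 the values are \<open>a\<close> and the slopes are multiples of \<open>b\<close>,
  so both sides vanish by \<open>a * b = 0\<close>. This supplies the condition at 0 in the
  comparison lemmas.\<close>

lemma eigen_branch_wronskian_0:
  assumes "eigen_branch a b L"
  shows "scaled' a b l R 0 * scaled a b k S 0 = scaled a b l R 0 * scaled' a b k S 0"
  using assms by (auto simp: eigen_branch_def scaled_0)

lemma eigen_branch_mono:
  assumes L: "eigen_branch a b L" and "0 < D" "D \<le> E"
  shows "0 \<le> (E/2)\<^sup>2 * (L E + 1/2) - (D/2)\<^sup>2 * (L D + 1/2)"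
    "(E/2)\<^sup>2 * (L E + 1/2) - (D/2)\<^sup>2 * (L D + 1/2) \<le> (E/2)^4/4 - (D/2)^4/4"
proof -
  have E: "0 < E" and le: "(D/2)^4/4 \<le> (E/2)^4/4"
    using assms by (auto intro!: divide_right_mono power_mono)
  note osc_eigenvalue_mono[OF osc_scaled osc_scaled eigen_branch_scaled(1)[OF L E] eigen_branch_scaled(1)[OF L \<open>0 < D\<close>]
    eigen_branch_wronskian_0[OF L] eigen_branch_scaled(2)[OF L E] eigen_branch_scaled(2)[OF L \<open>0 < D\<close>] le]
  then show "0 \<le> (E/2)\<^sup>2 * (L E + 1/2) - (D/2)\<^sup>2 * (L D + 1/2)"
    "(E/2)\<^sup>2 * (L E + 1/2) - (D/2)\<^sup>2 * (L D + 1/2) \<le> (E/2)^4/4 - (D/2)^4/4"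
    by blast+
qed

text \<open>The bounds of \<open>eigen_branch_mono\<close> squeeze the scaled eigenvalue from both
  sides of \<open>D\<close>. Continuity of \<open>L\<close> then makes the eigenfunctions depend
  continuously on \<open>D\<close>, as the derivative formula requires.\<close>

lemma eigen_branch_continuous:
  assumes L: "eigen_branch a b L"
  shows "continuous_on {0<..} L"
proof -
  define m where "m = (\<lambda>D. (D/2)\<^sup>2 * (L D + 1/2))"
  have "continuous_on {0<..} m"
    unfolding continuous_on_eq_continuous_at[OF open_greaterThan]
  proof
    fix D :: real assume D: "D \<in> {0<..}"
    have "((\<lambda>E. m E - m D) \<longlongrightarrow> 0) (at D)"
    proof (rule Lim_null_comparison)
      have "\<forall>\<^sub>F E in at D. E \<in> {0<..}"
        using D by (intro eventually_at_in_open') auto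
      then show "\<forall>\<^sub>F E in at D. norm (m E - m D) \<le> \<bar>(E/2)^4/4 - (D/2)^4/4\<bar>"
      proof eventually_elim
        case (elim E)
        then show ?case
          using eigen_branch_mono[OF L, of D E] eigen_branch_mono[OF L, of E D] D
          by (cases "D \<le> E") (auto simp: m_def)
      qed
      have "((\<lambda>E. \<bar>(E/2)^4/4 - (D/2)^4/4\<bar>) \<longlongrightarrow> \<bar>(D/2)^4/4 - (D/2)^4/4\<bar>) (at D)"
        by (intro tendsto_intros) auto
      then show "((\<lambda>E. \<bar>(E/2)^4/4 - (D/2)^4/4\<bar>) \<longlongrightarrow> 0) (at D)" by simp
    qed
    then show "isCont m D" by (simp add: isCont_def LIM_zero_iff)
  qed
  then have "continuous_on {0<..} (\<lambda>D. m D / (D/2)\<^sup>2 - 1/2)"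
    by (intro continuous_intros) auto
  then show ?thesis
    by (rule continuous_on_cong[THEN iffD1, rotated 2]) (auto simp: m_def)
qed

text \<open>A Hellmann-Feynman formula; \<open>D ^ 3 / 16\<close> is the derivative of
  \<open>t = D ^ 4 / 64\<close>. Green's identity between the lengths \<open>E\<close> and
  \<open>D\<close> expresses the difference quotient exactly through \<open>J E / I E\<close>, so
  only continuity of these integrals at \<open>D\<close> matters and no eigenfunction is
  differentiated in \<open>D\<close>.\<close>

lemma eigen_branch_deriv:
  assumes L: "eigen_branch a b L" and "D > 0"
  defines "v \<equiv> scaled a b (L D) (D/2)"
  shows "((\<lambda>D. (D/2)\<^sup>2 * (L D + 1/2)) has_real_derivative
     D ^ 3 / 16 * (integral {0..1} (\<lambda>x. x\<^sup>2 * (v x * v x)) / integral {0..1} (\<lambda>x. v x * v x))) (at D)"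
proof -
  define m where "m = (\<lambda>D. (D/2)\<^sup>2 * (L D + 1/2))"
  define u where "u = (\<lambda>E. scaled a b (L E) (E/2))"
  define I where "I = (\<lambda>E. integral (cbox 0 1) (\<lambda>x. u E x * v x))"
  define J where "J = (\<lambda>E. integral (cbox 0 1) (\<lambda>x. x\<^sup>2 * (u E x * v x)))"
  note Lc = continuous_on_compose2[OF eigen_branch_continuous[OF L], of _ fst]
  have v: "continuous_on S v" for S unfolding v_def by (rule osc_continuous[OF osc_scaled])
  have u: "continuous_on ({0<..} \<times> cbox 0 1) (\<lambda>p. u (fst p) (snd p))"
    unfolding u_def scaled_def by (intro continuous_intros Lc) auto
  have vs: "continuous_on ({0<..} \<times> cbox (0::real) 1) (\<lambda>p :: real \<times> real. v (snd p))"
    by (rule continuous_on_compose2[OF v[of UNIV]]) (auto intro: continuous_intros)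
  have "continuous_on {0<..} I" "continuous_on {0<..} J"
    unfolding I_def J_def
    by (rule integral_continuous_on_param, simp only: case_prod_unfold, intro continuous_intros u vs)+
  then have IJ: "isCont I D" "isCont J D"
    using \<open>D > 0\<close> by (auto simp: continuous_on_eq_continuous_at)
  have cmp: "(m E - m D) * I E = ((E/2)^4/4 - (D/2)^4/4) * J E" "0 < J E" "J E < I E" if "E > 0" for E
  proof -
    note osc_compare[OF osc_scaled osc_scaled eigen_branch_scaled(1)[OF L that] eigen_branch_scaled(1)[OF L \<open>0 < D\<close>]
      eigen_branch_wronskian_0[OF L] eigen_branch_scaled(2)[OF L that] eigen_branch_scaled(2)[OF L \<open>0 < D\<close>]]
    then show "(m E - m D) * I E = ((E/2)^4/4 - (D/2)^4/4) * J E" "0 < J E" "J E < I E"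
      by (auto simp: m_def I_def J_def u_def v_def)
  qed
  have "I D \<noteq> 0" using cmp(2,3)[OF \<open>D > 0\<close>] by simp
  \<comment> \<open>The polynomial factor is the difference quotient of \<open>t\<close>, namely
    \<open>(E^4 - D^4) / (64 * (E - D))\<close>, with \<open>E - D\<close> cancelled.\<close>
  have "((\<lambda>E. (E^3 + E\<^sup>2 * D + E * D\<^sup>2 + D^3) / 64 * (J E / I E)) \<longlongrightarrow>
      (D^3 + D\<^sup>2 * D + D * D\<^sup>2 + D^3) / 64 * (J D / I D)) (at D)"
    using IJ \<open>I D \<noteq> 0\<close> unfolding isCont_def by (intro tendsto_intros) auto
  also have "(D^3 + D\<^sup>2 * D + D * D\<^sup>2 + D^3) / 64 * (J D / I D) = D ^ 3 / 16 * (J D / I D)"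
    by (simp add: power2_eq_square power3_eq_cube)
  finally have "((\<lambda>E. (m E - m D) / (E - D)) \<longlongrightarrow> D ^ 3 / 16 * (J D / I D)) (at D)"
  proof (rule Lim_transform_eventually)
    have "\<forall>\<^sub>F E in at D. E \<in> {0<..} - {D}"
      using \<open>D > 0\<close> by (intro eventually_at_in_open) auto
    then show "\<forall>\<^sub>F E in at D. (E^3 + E\<^sup>2 * D + E * D\<^sup>2 + D^3) / 64 * (J E / I E) = (m E - m D) / (E - D)"
    proof eventually_elim
      case (elim E)
      then have "E > 0" "E - D \<noteq> 0" by auto
      have "I E \<noteq> 0" using cmp(2,3)[OF \<open>E > 0\<close>] by simp
      have "m E - m D = ((E/2)^4/4 - (D/2)^4/4) * J E / I E"
        using cmp(1)[OF \<open>E > 0\<close>] \<open>I E \<noteq> 0\<close> by (metis nonzero_eq_divide_eq)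
      also have "(E/2)^4/4 - (D/2)^4/4 = (E - D) * ((E^3 + E\<^sup>2 * D + E * D\<^sup>2 + D^3) / 64)"
        by (simp add: field_simps power2_eq_square power3_eq_cube power4_eq_xxxx)
      finally show ?case using \<open>E - D \<noteq> 0\<close> by simp
    qed
  qed
  then show ?thesis
    unfolding has_field_derivative_iff I_def J_def by (simp add: m_def u_def v_def)
qed

text \<open>Comparison with a problem at \<open>t = 0\<close> bounds the scaled eigenvalue between
  \<open>k\<close> and \<open>k + (D/2)^4/4\<close>. The conditions on \<open>w 0\<close> and
  \<open>w' 0\<close> match the initial data of the branch.\<close>

lemma eigen_branch_limit:
  assumes L: "eigen_branch a b L" and w: "osc 0 k w w'" "w 1 = 0" "b * w 0 = 0" "a * w' 0 = 0"
    and wpos: "\<And>x. 0 < x \<Longrightarrow> x < 1 \<Longrightarrow> w x > 0"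
  shows "((\<lambda>D. (D/2)\<^sup>2 * (L D + 1/2)) \<longlongrightarrow> k) (at_right 0)"
proof (rule tendsto_sandwich)
  have *: "0 \<le> (D/2)\<^sup>2 * (L D + 1/2) - k \<and> (D/2)\<^sup>2 * (L D + 1/2) - k \<le> (D/2)^4/4 - 0" if "D > 0" for D
  proof -
    have "scaled' a b (L D) (D/2) 0 * w 0 = scaled a b (L D) (D/2) 0 * w' 0"
      using w by (auto simp: scaled_0)
    note osc_eigenvalue_mono[OF osc_scaled w(1) eigen_branch_scaled(1)[OF L that] w(2) this
      eigen_branch_scaled(2)[OF L that] wpos]
    then show ?thesis by simp
  qed
  show "\<forall>\<^sub>F D in at_right 0. k \<le> (D/2)\<^sup>2 * (L D + 1/2)"
    using eventually_at_right_less[of 0] by eventually_elim (use * in force)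
  show "\<forall>\<^sub>F D in at_right 0. (D/2)\<^sup>2 * (L D + 1/2) \<le> k + (D/2)^4/4"
    using eventually_at_right_less[of 0] by eventually_elim (use * in force)
  have "((\<lambda>D. k + (D/2)^4/4) \<longlongrightarrow> k + (0/2)^4/4) (at_right 0)"
    by (intro tendsto_intros) auto
  then show "((\<lambda>D. k + (D/2)^4/4) \<longlongrightarrow> k) (at_right 0)" by simp
qed auto

section \<open>Identification of the first two eigenvalues and conclusion\<close>

lemma dirichlet_eigenvalues:
  assumes "D > 0"
  shows "dirichlet_eigenvalue 1 D < dirichlet_eigenvalue 2 D"
    and "hsol 0 1 (dirichlet_eigenvalue 2 D) (D/2) = 0"
    and "\<And>s. s \<in> {0<..<D/2} \<Longrightarrow> hsol 0 1 (dirichlet_eigenvalue 2 D) s > 0"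
    and "hsol 1 0 (dirichlet_eigenvalue 1 D) (D/2) = 0"
    and "\<And>s. s \<in> {0..<D/2} \<Longrightarrow> hsol 1 0 (dirichlet_eigenvalue 1 D) s > 0"
proof -
  have "D/2 > 0" using assms by simp
  obtain l where l: "l > 0" "hsol 0 1 l (D/2) = 0" "\<And>s. s \<in> {0<..<D/2} \<Longrightarrow> hsol 0 1 l s > 0"
    "\<And>k s. k < l \<Longrightarrow> s \<in> {0<..D/2} \<Longrightarrow> hsol 0 1 k s > 0"
    using second_eigenvalue_exists[OF \<open>D/2 > 0\<close>] by metis
  obtain k where k: "0 < k" "k < l" "hsol 1 0 k (D/2) = 0" "\<And>s. s \<in> {0..<D/2} \<Longrightarrow> hsol 1 0 k s > 0"
    "\<And>j. j \<le> l \<Longrightarrow> hsol 1 0 j (D/2) = 0 \<Longrightarrow> j = k"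
    using first_eigenvalue_exists[OF \<open>D/2 > 0\<close> l] by metis
  \<comment> \<open>Below \<open>l\<close> the odd solution does not vanish at \<open>D/2\<close>,
    and the even one does so only at \<open>k\<close>; at \<open>l\<close> itself the odd one
    vanishes.\<close>
  have ev: "is_dirichlet_eigenvalue D j \<and> j \<le> l \<longleftrightarrow> j = k \<or> j = l" for j
    unfolding is_dirichlet_eigenvalue_iff[OF assms]
    using k(2,3) k(5)[of j] l(2) l(4)[of j "D/2"] assms by (cases "j < l") auto
  have S1: "{j. is_dirichlet_eigenvalue D j \<and> j \<le> k} = {k}" and S2: "{j. is_dirichlet_eigenvalue D j \<and> j \<le> l} = {k, l}"
    using ev \<open>k < l\<close> by force+
  have 1: "dirichlet_eigenvalue 1 D = k"
    by (rule dirichlet_eigenvalue_eqI) (use S1 in auto)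
  have 2: "dirichlet_eigenvalue 2 D = l"
    by (rule dirichlet_eigenvalue_eqI) (use S2 \<open>k < l\<close> in auto)
  show "dirichlet_eigenvalue 1 D < dirichlet_eigenvalue 2 D"
    "hsol 0 1 (dirichlet_eigenvalue 2 D) (D/2) = 0"
    "\<And>s. s \<in> {0<..<D/2} \<Longrightarrow> hsol 0 1 (dirichlet_eigenvalue 2 D) s > 0"
    "hsol 1 0 (dirichlet_eigenvalue 1 D) (D/2) = 0"
    "\<And>s. s \<in> {0..<D/2} \<Longrightarrow> hsol 1 0 (dirichlet_eigenvalue 1 D) s > 0"
    unfolding 1 2 using k l by auto
qed

lemma eigen_branch_first: "eigen_branch 1 0 (dirichlet_eigenvalue 1)"
  unfolding eigen_branch_def using dirichlet_eigenvalues(4,5) by auto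

lemma eigen_branch_second: "eigen_branch 0 1 (dirichlet_eigenvalue 2)"
  unfolding eigen_branch_def using dirichlet_eigenvalues(2,3) by auto

theorem theorem11:
  defines "g \<equiv> \<lambda>D::real. (dirichlet_eigenvalue 2 D - dirichlet_eigenvalue 1 D) * D\<^sup>2"
  shows "strict_mono_on {0<..} g \<and>
         (\<forall>D>0. \<exists>d>0. (g has_real_derivative d) (at D)) \<and>
         (g \<longlongrightarrow> 3 * pi\<^sup>2) (at_right 0)"
proof -
  have g: "g = (\<lambda>D. 4 * ((D/2)\<^sup>2 * (dirichlet_eigenvalue 2 D + 1/2) - (D/2)\<^sup>2 * (dirichlet_eigenvalue 1 D + 1/2)))"
    by (simp add: g_def fun_eq_iff field_simps power2_eq_square)
  have deriv: "\<exists>d>0. (g has_real_derivative d) (at D)" if D: "D > 0" for D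
  proof -
    let ?v = "scaled 1 0 (dirichlet_eigenvalue 1 D) (D/2)" and ?w = "scaled 0 1 (dirichlet_eigenvalue 2 D) (D/2)"
    let ?M = "\<lambda>v. integral {0..1} (\<lambda>x. x\<^sup>2 * (v x * v x)) / integral {0..1} (\<lambda>x. v x * v x)"
    \<comment> \<open>By \<open>eigen_branch_deriv\<close> this inequality is the positivity of the
      derivative of \<open>g\<close>.\<close>
    have "?M ?v < ?M ?w"
    proof (rule second_moment_less[OF osc_scaled osc_scaled])
      show "(D/2)\<^sup>2 * (dirichlet_eigenvalue 1 D + 1/2) < (D/2)\<^sup>2 * (dirichlet_eigenvalue 2 D + 1/2)"
        using dirichlet_eigenvalues(1)[OF D] D by simp
      show "?v x > 0" if "0 \<le> x" "x < 1" for x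
        unfolding scaled_pos_iff by (rule dirichlet_eigenvalues(5)[OF D]) (use that D in auto)
      show "?w x > 0" if "0 < x" "x < 1" for x
        by (rule eigen_branch_scaled(2)[OF eigen_branch_second D that])
    qed (use dirichlet_eigenvalues[OF D] in \<open>auto simp: scaled_0 scaled_1\<close>)
    then have "D ^ 3 / 16 * ?M ?v < D ^ 3 / 16 * ?M ?w"
      using D by (intro mult_strict_left_mono) auto
    then have "4 * (D ^ 3 / 16 * ?M ?w - D ^ 3 / 16 * ?M ?v) > 0"
      by (intro mult_pos_pos) (simp_all only: diff_gt_0_iff_gt zero_less_numeral)
    moreover have "(g has_real_derivative 4 * (D ^ 3 / 16 * ?M ?w - D ^ 3 / 16 * ?M ?v)) (at D)"
      unfolding g
      by (intro DERIV_cmult DERIV_diff eigen_branch_deriv[OF eigen_branch_second D] eigen_branch_deriv[OF eigen_branch_first D])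
    ultimately show ?thesis by blast
  qed
  have "strict_mono_on {0<..} g"
  proof (rule strict_mono_onI)
    fix x y :: real assume "x \<in> {0<..}" "x < y"
    show "g x < g y"
    proof (rule DERIV_pos_imp_increasing[OF \<open>x < y\<close>])
      show "\<exists>d. (g has_real_derivative d) (at z) \<and> d > 0" if "x \<le> z" for z
        using deriv[of z] that \<open>x \<in> {0<..}\<close> by auto
    qed
  qed
  moreover have "(g \<longlongrightarrow> 4 * (pi\<^sup>2 - (pi/2)\<^sup>2)) (at_right 0)"
    unfolding g
  \<comment> \<open>At \<open>t = 0\<close> the odd and even problems are solved by
    \<open>sin (pi * x)\<close> and \<open>cos (pi/2 * x)\<close>, with eigenvalues
    \<open>pi\<^sup>2\<close> and \<open>(pi/2)\<^sup>2\<close>.\<close>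
  proof (intro tendsto_mult tendsto_const tendsto_diff)
    show "((\<lambda>D. (D/2)\<^sup>2 * (dirichlet_eigenvalue 2 D + 1/2)) \<longlongrightarrow> pi\<^sup>2) (at_right 0)"
      by (rule eigen_branch_limit[OF eigen_branch_second osc_sin[of pi]]) (auto intro!: sin_gt_zero)
    show "((\<lambda>D. (D/2)\<^sup>2 * (dirichlet_eigenvalue 1 D + 1/2)) \<longlongrightarrow> (pi/2)\<^sup>2) (at_right 0)"
      by (rule eigen_branch_limit[OF eigen_branch_first osc_cos[of "pi/2"]]) (auto intro!: cos_gt_zero)
  qed
  moreover have "4 * (pi\<^sup>2 - (pi/2)\<^sup>2) = 3 * pi\<^sup>2" by (simp add: power2_eq_square)
  ultimately show ?thesis using deriv by auto
qed

end
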